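(* Let $\mathbb F\in\{\mathbb R,\mathbb C\}$, let $V$ be a vector space over $\mathbb F$, let $X\subseteq V$ be a vector subspace, and let $\mu:(0,1]\times X\to V$, $(\alpha,x)\mapsto x_\alpha$, be a fuzzy labeling with associated tail spaces $\widetilde X_\alpha=\operatorname{span}\{x_\beta : x\in X,\ \beta\in[\alpha,1]\}$, $\alpha\in(0,1]$. Assume that $X_0:=\bigcup_{\alpha\in(0,1]}\widetilde X_\alpha=V$. Define $\nu:V\to[0,1]$ by $$\nu(v)=\sup\{\alpha\in(0,1] : v\in\widetilde X_\alpha\},$$ where the supremum of the empty set is taken to be $0$. Then $(V,\nu)$ is a fuzzy vector space in the sense of Lubczonok.
   Context: A fuzzy labeling on a vector subspace $X$ of $V$ is a mapping $\mu:(0,1]\times X\to V$, $(\alpha,x)\mapsto x_\alpha$, with $x_1=x$ for all $x\in X$. The tail spaces are nested: $\alpha_1<\alpha_2$ implies $\widetilde X_{\alpha_2}\subseteq\widetilde X_{\alpha_1}$; also $\widetilde X_1=X$. A fuzzy vector space in the sense of Lubczonok is a pair $(V,\nu)$, where $V$ is a vector space over $\mathbb F$ and $\nu:V\to[0,1]$ satisfies $\nu(ax+by)\ge\nu(x)\wedge\nu(y)$ for all $x,y\in V$ and all $a,b\in\mathbb F$, with $\wedge$ denoting the minimum. *)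

theory Defs
  imports Complex_Main
begin

text \<open>
  The ambient space \<open>V\<close> is the whole type \<open>'v\<close>, with scalar multiplication \<open>scale\<close> over the
  scalar field \<open>'k\<close>. A labeling \<open>\<mu>\<close> is a total function in which only the values
  \<open>\<mu> \<alpha> x\<close> with \<open>\<alpha> \<in> {0<..1}\<close> and \<open>x \<in> X\<close> are meaningful.
\<close>

definition fuzzy_labeling ::
  "('k::field \<Rightarrow> 'v::ab_group_add \<Rightarrow> 'v) \<Rightarrow> 'v set \<Rightarrow> (real \<Rightarrow> 'v \<Rightarrow> 'v) \<Rightarrow> bool" where
  "fuzzy_labeling scale X \<mu> \<longleftrightarrow>
     vector_space scale \<and> module.subspace scale X \<and> (\<forall>x\<in>X. \<mu> 1 x = x)"

definition tail_space ::
  "('k::field \<Rightarrow> 'v::ab_group_add \<Rightarrow> 'v) \<Rightarrow> 'v set \<Rightarrow> (real \<Rightarrow> 'v \<Rightarrow> 'v) \<Rightarrow> real \<Rightarrow> 'v set" where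
  "tail_space scale X \<mu> \<alpha> = module.span scale {\<mu> \<beta> x | x \<beta>. x \<in> X \<and> \<beta> \<in> {\<alpha>..1}}"

text \<open>The case distinction is needed because \<open>Sup {}\<close> is not specified to be \<open>0\<close> on the reals.\<close>

definition tail_membership ::
  "('k::field \<Rightarrow> 'v::ab_group_add \<Rightarrow> 'v) \<Rightarrow> 'v set \<Rightarrow> (real \<Rightarrow> 'v \<Rightarrow> 'v) \<Rightarrow> 'v \<Rightarrow> real" where
  "tail_membership scale X \<mu> v =
     (let A = {\<alpha> \<in> {0<..1}. v \<in> tail_space scale X \<mu> \<alpha>} in if A = {} then 0 else Sup A)"

text \<open>Fuzzy vector spaces in the sense of Lubczonok.\<close>

definition fuzzy_vector_space ::
  "('k::field \<Rightarrow> 'v::ab_group_add \<Rightarrow> 'v) \<Rightarrow> ('v \<Rightarrow> real) \<Rightarrow> bool" where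
  "fuzzy_vector_space scale \<nu> \<longleftrightarrow>
     vector_space scale \<and> range \<nu> \<subseteq> {0..1} \<and>
     (\<forall>x y a b. min (\<nu> x) (\<nu> y) \<le> \<nu> (scale a x + scale b y))"

end

theory Submission
  imports Defs
begin

text \<open>The function \<nu> is recovered from a nested family of subspaces, and its superlevel
  sets are controlled by that family. Raising the index leaves fewer generators, so the tail spaces
  shrink; hence t < \<nu>(v) with t \<ge> 0 forces v into the tail space at t
  (\<open>in_tail_space_if_less_tail_membership\<close>). Conversely, membership at an index t in
  (0,1] gives t \<le> \<nu>(v) (\<open>tail_membership_upper\<close>). For 0 < t < min (\<nu>(x))
  (\<nu>(y)), both vectors lie in the tail space at t, hence so does every linear combination of
  them, whose value is then at least t. Letting t increase to the minimum gives the
  inequality.\<close>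

lemma tail_space_antimono:
  assumes "vector_space scale" and "\<alpha> \<le> \<beta>"
  shows "tail_space scale X \<mu> \<beta> \<subseteq> tail_space scale X \<mu> \<alpha>"
proof -
  interpret vector_space scale by fact
  show ?thesis
    unfolding tail_space_def using assms(2) by (intro span_mono) (auto 0 4 intro: order_trans)
qed

lemma tail_membership_upper:
  assumes "v \<in> tail_space scale X \<mu> \<alpha>" and "0 < \<alpha>" and "\<alpha> \<le> 1"
  shows "\<alpha> \<le> tail_membership scale X \<mu> v"
proof -
  let ?A = "{\<alpha> \<in> {0<..1}. v \<in> tail_space scale X \<mu> \<alpha>}"
  have "\<alpha> \<in> ?A"
    using assms by simp
  moreover have "bdd_above ?A"
    by (rule bdd_aboveI[of _ 1]) simp
  ultimately show ?thesis
    unfolding tail_membership_def Let_def using cSup_upper[of \<alpha> ?A] by auto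
qed

lemma tail_membership_nonneg: "0 \<le> tail_membership scale X \<mu> v"
proof (cases "\<exists>\<alpha>\<in>{0<..1}. v \<in> tail_space scale X \<mu> \<alpha>")
  case True
  then show ?thesis
    using tail_membership_upper by fastforce
next
  case False
  then show ?thesis
    by (auto simp: tail_membership_def Let_def)
qed

lemma tail_membership_le_1: "tail_membership scale X \<mu> v \<le> 1"
proof -
  let ?A = "{\<alpha> \<in> {0<..1}. v \<in> tail_space scale X \<mu> \<alpha>}"
  have "Sup ?A \<le> 1" if "?A \<noteq> {}"
    using that by (rule cSup_least) simp
  then show ?thesis
    by (simp only: tail_membership_def Let_def split: if_split) simp
qed

text \<open>Some admissible index exceeds t, and nesting carries membership down to t. The
  inequality is strict because the supremum need not be attained.\<close>

lemma in_tail_space_if_less_tail_membership: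
  assumes "vector_space scale" and "0 \<le> t" and "t < tail_membership scale X \<mu> v"
  shows "v \<in> tail_space scale X \<mu> t"
proof -
  let ?A = "{\<alpha> \<in> {0<..1}. v \<in> tail_space scale X \<mu> \<alpha>}"
  \<comment> \<open>If the set of indices were empty, the default value 0 would give t < 0,
    contradicting \<open>0 \<le> t\<close>.\<close>
  have ne: "?A \<noteq> {}" and less: "t < Sup ?A"
    using assms(2,3) unfolding tail_membership_def Let_def by (auto simp: Let_def split: if_splits)
  obtain \<alpha> where "\<alpha> \<in> ?A" and "t < \<alpha>"
    using less_cSupD[OF ne less] by blast
  then show ?thesis
    using tail_space_antimono[OF assms(1), of t \<alpha>] by auto
qed

text \<open>Stated over an arbitrary field, so that the real and the complex case are both
  instances.\<close>

lemma fuzzy_vector_space_tail_membership: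
  assumes "vector_space scale"
  shows "fuzzy_vector_space scale (tail_membership scale X \<mu>)"
proof -
  interpret vector_space scale by fact
  let ?\<nu> = "tail_membership scale X \<mu>"
  have "min (?\<nu> x) (?\<nu> y) \<le> ?\<nu> (scale a x + scale b y)" for x y a b
  \<comment> \<open>The approximation from below needs a nonempty open interval between 0 and the
    minimum, which also keeps t a positive index. If the minimum is not positive, nonnegativity of
    \<nu> suffices.\<close>
  proof (cases "0 < min (?\<nu> x) (?\<nu> y)")
    case True
    then show ?thesis
    proof (rule dense_le_bounded)
      fix t assume t: "0 < t" "t < min (?\<nu> x) (?\<nu> y)"
      then have "x \<in> tail_space scale X \<mu> t" and "y \<in> tail_space scale X \<mu> t"
        using assms by (simp_all add: in_tail_space_if_less_tail_membership)
      then have "scale a x + scale b y \<in> tail_space scale X \<mu> t"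
        unfolding tail_space_def by (intro span_add span_scale)
      \<comment> \<open>Only indices in (0,1] enter the supremum, so t must be admissible before it
        can bound the value from below.\<close>
      moreover have "t \<le> 1"
        using t tail_membership_le_1[of scale X \<mu> x] by simp
      ultimately show "t \<le> ?\<nu> (scale a x + scale b y)"
        using t tail_membership_upper by blast
    qed
  next
    case False
    then show ?thesis
      using tail_membership_nonneg[of scale X \<mu> "scale a x + scale b y"] by linarith
  qed
  then show ?thesis
    using assms tail_membership_nonneg tail_membership_le_1
    unfolding fuzzy_vector_space_def by auto
qed

theorem theorem5p1:
  "(\<forall>(scale :: real \<Rightarrow> 'v::ab_group_add \<Rightarrow> 'v) X \<mu>.
      vector_space scale \<longrightarrow> module.subspace scale X \<longrightarrow> fuzzy_labeling scale X \<mu> \<longrightarrow>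
      (\<Union>\<alpha>\<in>{0<..1}. tail_space scale X \<mu> \<alpha>) = UNIV \<longrightarrow>
      fuzzy_vector_space scale (tail_membership scale X \<mu>)) \<and>
   (\<forall>(scale :: complex \<Rightarrow> 'v \<Rightarrow> 'v) X \<mu>.
      vector_space scale \<longrightarrow> module.subspace scale X \<longrightarrow> fuzzy_labeling scale X \<mu> \<longrightarrow>
      (\<Union>\<alpha>\<in>{0<..1}. tail_space scale X \<mu> \<alpha>) = UNIV \<longrightarrow>
      fuzzy_vector_space scale (tail_membership scale X \<mu>))"
  by (simp add: fuzzy_vector_space_tail_membership)

end
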